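(* (1) Let $\mathbb{P}_\tau=(P_o,P_a,\vDash,\mathcal{F}_\tau)$ be an attribute continuous formal context. Then the set $\mathfrak{B}(P_a,\mathcal{F}_\tau)$ of its continuous formal concepts, ordered by set inclusion, is a continuous domain. (2) Conversely, for every continuous domain $(D,\leq)$ there exists an attribute continuous formal context $\mathbb{P}_\tau=(P_o,P_a,\vDash,\mathcal{F}_\tau)$ such that $(D,\leq)$ is order isomorphic to $(\mathfrak{B}(P_a,\mathcal{F}_\tau),\subseteq)$.
   Context: Domain theory. Posets are assumed nonempty. A dcpo is a poset in which every directed (nonempty, upward directed) subset has a least upper bound. In a dcpo $P$, $x\ll y$ means: for every directed $D\subseteq P$ with $y\leq\bigvee D$ there is $d\in D$ with $x\leq d$. A basis of $P$ is a subset $B\subseteq P$ such that for every $x\in P$ the set $\{b\in B: b\ll x\}$ is directed with least upper bound $x$. A continuous domain is a dcpo that has a basis. Notation: $M\sqsubseteq X$ means that $M$ is a finite subset of $X$ (possibly empty). A formal context is a triple $(P_o,P_a,\vDash)$ with sets $P_o$ (objects), $P_a$ (attributes) and a relation $\vDash\subseteq P_o\times P_a$. Define $\alpha:\mathcal{P}(P_o)\to\mathcal{P}(P_a)$, $\alpha(A)=\{n\in P_a:\forall m\in A,\ m\vDash n\}$ and $\omega:\mathcal{P}(P_a)\to\mathcal{P}(P_o)$, $\omega(B)=\{m\in P_o:\forall n\in B,\ m\vDash n\}$. A kernel attribute operator on $(P_o,P_a,\vDash)$ is a map $\tau:\mathcal{P}(P_a)\to\mathcal{P}(P_a)$ such that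 for all $B,B_1\subseteq P_a$: $\tau(\alpha(\omega(B)))\subseteq\alpha(\omega(B))$; $\tau(\tau(\alpha(\omega(B))))=\tau(\alpha(\omega(B)))$; and $\tau(\alpha(\omega(B)))\subseteq\tau(\alpha(\omega(B_1)))$ whenever $B\subseteq B_1$. Write $\lceil B\rceil=\tau(\alpha(\omega(B)))$. A $\tau$-consistent selection is a nonempty family $\mathcal{F}_\tau$ of nonempty finite subsets of $P_a$ such that for every $F\in\mathcal{F}_\tau$ and every $M\sqsubseteq\lceil F\rceil$ there is $G\in\mathcal{F}_\tau$ with $M\subseteq\lceil G\rceil$ and $G\subseteq\lceil F\rceil$. An attribute continuous formal context is a structure $\mathbb{P}_\tau=(P_o,P_a,\vDash,\mathcal{F}_\tau)$ where $(P_o,P_a,\vDash)$ is a formal context, $\tau$ is a kernel attribute operator on it and $\mathcal{F}_\tau$ is a $\tau$-consistent selection. A continuous formal concept of $\mathbb{P}_\tau$ is a subset $Q\subseteq P_a$ such that for every $M\sqsubseteq Q$ there is $F\in\mathcal{F}_\tau$ with $M\subseteq\lceil F\rceil\subseteq Q$. The set of all of them is $\mathfrak{B}(P_a,\mathcal{F}_\tau)$. *)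

theory Defs
  imports "HOL-Algebra.Lattice" "HOL-Library.FuncSet"
begin

section \<open>Continuous domains\<close>

definition directed_in :: "('a, 'b) gorder_scheme \<Rightarrow> 'a set \<Rightarrow> bool" where
  "directed_in L D \<longleftrightarrow>
     D \<subseteq> carrier L \<and> D \<noteq> {} \<and> (\<forall>x\<in>D. \<forall>y\<in>D. \<exists>z\<in>D. x \<sqsubseteq>\<^bsub>L\<^esub> z \<and> y \<sqsubseteq>\<^bsub>L\<^esub> z)"

text \<open>The HOL-Algebra locale \<^locale>\<open>partial_order\<close> admits an empty carrier; posets here are nonempty.\<close>

locale dcpo = partial_order +
  assumes carrier_nonempty: "carrier L \<noteq> {}"
    and directed_has_lub: "directed_in L D \<Longrightarrow> \<exists>s. is_lub L s D"

text \<open>Only used in dcpos, where \<open>s\<close> below ranges over the unique least upper bound of \<open>D\<close>.\<close>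

definition way_below :: "('a, 'b) gorder_scheme \<Rightarrow> 'a \<Rightarrow> 'a \<Rightarrow> bool" where
  "way_below L x y \<longleftrightarrow>
     x \<in> carrier L \<and> y \<in> carrier L \<and>
     (\<forall>D s. directed_in L D \<and> is_lub L s D \<and> y \<sqsubseteq>\<^bsub>L\<^esub> s \<longrightarrow> (\<exists>d\<in>D. x \<sqsubseteq>\<^bsub>L\<^esub> d))"

definition domain_basis :: "('a, 'b) gorder_scheme \<Rightarrow> 'a set \<Rightarrow> bool" where
  "domain_basis L B \<longleftrightarrow>
     B \<subseteq> carrier L \<and>
     (\<forall>x\<in>carrier L. directed_in L {b \<in> B. way_below L b x} \<and>
                    is_lub L x {b \<in> B. way_below L b x})"

locale continuous_domain = dcpo +
  assumes has_basis: "\<exists>B. domain_basis L B"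

definition order_isomorphic :: "('a, 'c) gorder_scheme \<Rightarrow> ('b, 'd) gorder_scheme \<Rightarrow> bool" where
  "order_isomorphic L L' \<longleftrightarrow> (\<exists>f. bij_betw f (carrier L) (carrier L') \<and> order_emb L L' f)"


section \<open>Attribute continuous formal contexts\<close>

locale formal_context =
  fixes objs :: "'m set" and attrs :: "'n set" and inc :: "('m \<times> 'n) set"
  assumes inc_subset: "inc \<subseteq> objs \<times> attrs"

definition ctx_alpha :: "'n set \<Rightarrow> ('m \<times> 'n) set \<Rightarrow> 'm set \<Rightarrow> 'n set" where
  "ctx_alpha attrs inc A = {n \<in> attrs. \<forall>m\<in>A. (m, n) \<in> inc}"

definition ctx_omega :: "'m set \<Rightarrow> ('m \<times> 'n) set \<Rightarrow> 'n set \<Rightarrow> 'm set" where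
  "ctx_omega objs inc B = {m \<in> objs. \<forall>n\<in>B. (m, n) \<in> inc}"

definition attr_closure :: "'m set \<Rightarrow> 'n set \<Rightarrow> ('m \<times> 'n) set \<Rightarrow> 'n set \<Rightarrow> 'n set" where
  "attr_closure objs attrs inc B = ctx_alpha attrs inc (ctx_omega objs inc B)"

locale kernel_attribute_operator = formal_context objs attrs inc
  for objs :: "'m set" and attrs :: "'n set" and inc :: "('m \<times> 'n) set" +
  fixes \<tau> :: "'n set \<Rightarrow> 'n set"
  assumes kernel_maps: "\<tau> \<in> Pow attrs \<rightarrow> Pow attrs"
    and kernel_contractive:
      "B \<subseteq> attrs \<Longrightarrow> \<tau> (attr_closure objs attrs inc B) \<subseteq> attr_closure objs attrs inc B"
    and kernel_idempotent:
      "B \<subseteq> attrs \<Longrightarrow>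
         \<tau> (\<tau> (attr_closure objs attrs inc B)) = \<tau> (attr_closure objs attrs inc B)"
    and kernel_mono:
      "B \<subseteq> B1 \<Longrightarrow> B1 \<subseteq> attrs \<Longrightarrow>
         \<tau> (attr_closure objs attrs inc B) \<subseteq> \<tau> (attr_closure objs attrs inc B1)"

text \<open>This is \<open>\<lceil>B\<rceil>\<close>, for \<open>B \<subseteq> attrs\<close>.\<close>

definition kernel_hull ::
    "'m set \<Rightarrow> 'n set \<Rightarrow> ('m \<times> 'n) set \<Rightarrow> ('n set \<Rightarrow> 'n set) \<Rightarrow> 'n set \<Rightarrow> 'n set" where
  "kernel_hull objs attrs inc \<tau> B = \<tau> (attr_closure objs attrs inc B)"

definition consistent_selection ::
    "'m set \<Rightarrow> 'n set \<Rightarrow> ('m \<times> 'n) set \<Rightarrow> ('n set \<Rightarrow> 'n set) \<Rightarrow> 'n set set \<Rightarrow> bool" where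
  "consistent_selection objs attrs inc \<tau> \<F> \<longleftrightarrow>
     \<F> \<noteq> {} \<and>
     (\<forall>F\<in>\<F>. F \<noteq> {} \<and> finite F \<and> F \<subseteq> attrs) \<and>
     (\<forall>F\<in>\<F>. \<forall>M. finite M \<and> M \<subseteq> kernel_hull objs attrs inc \<tau> F \<longrightarrow>
        (\<exists>G\<in>\<F>. M \<subseteq> kernel_hull objs attrs inc \<tau> G \<and> G \<subseteq> kernel_hull objs attrs inc \<tau> F))"

locale attribute_continuous_context = kernel_attribute_operator objs attrs inc \<tau>
  for objs :: "'m set" and attrs :: "'n set" and inc :: "('m \<times> 'n) set"
    and \<tau> :: "'n set \<Rightarrow> 'n set" +
  fixes \<F> :: "'n set set"
  assumes selection: "consistent_selection objs attrs inc \<tau> \<F>"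

definition continuous_concepts ::
    "'m set \<Rightarrow> 'n set \<Rightarrow> ('m \<times> 'n) set \<Rightarrow> ('n set \<Rightarrow> 'n set) \<Rightarrow> 'n set set \<Rightarrow> 'n set set" where
  "continuous_concepts objs attrs inc \<tau> \<F> =
     {Q. Q \<subseteq> attrs \<and>
         (\<forall>M. finite M \<and> M \<subseteq> Q \<longrightarrow>
            (\<exists>F\<in>\<F>. M \<subseteq> kernel_hull objs attrs inc \<tau> F \<and>
                    kernel_hull objs attrs inc \<tau> F \<subseteq> Q))}"

definition concept_poset ::
    "'m set \<Rightarrow> 'n set \<Rightarrow> ('m \<times> 'n) set \<Rightarrow> ('n set \<Rightarrow> 'n set) \<Rightarrow> 'n set set \<Rightarrow> 'n set gorder" where
  "concept_poset objs attrs inc \<tau> \<F> =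
     \<lparr>carrier = continuous_concepts objs attrs inc \<tau> \<F>, eq = (=), le = (\<subseteq>)\<rparr>"

end

theory Submission
  imports Defs
begin

text \<open>
  Every hull \<open>\<lceil>F\<rceil>\<close> with \<open>F \<in> \<F>\<close> is a concept, directed suprema of concepts are unions, and
  \<open>\<lceil>F\<rceil>\<close> is way below \<open>Q\<close> as soon as \<open>F \<subseteq> Q\<close>, because \<open>F\<close> is finite. Every concept \<open>Q\<close> is the
  directed union of the hulls \<open>\<lceil>G\<rceil>\<close> with \<open>G \<in> \<F>\<close> and \<open>G \<subseteq> Q\<close>, so the hulls form a basis.

  Conversely, given a domain \<open>D\<close> with basis \<open>B\<close>, take \<open>D\<close> as objects, \<open>B\<close> as attributes, \<open>m \<Turnstile> n\<close>
  iff \<open>n \<le> m\<close>, the singletons of \<open>B\<close> as selection, and let \<open>\<tau> X\<close> consist of the basis elements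
  way below some member of \<open>X\<close>. Then \<open>\<lceil>{b}\<rceil>\<close> is the set of basis elements way below \<open>b\<close>, the
  concepts are the rounded ideals of \<open>B\<close>, and these are the sets of basis elements way below the
  points of \<open>D\<close>.
\<close>

section \<open>Suprema and the way-below relation\<close>

text \<open>\<open>Upper\<close> tests only the members of \<open>A\<close> that lie in the carrier,
  hence the hypothesis.\<close>

lemma is_lub_iff:
  assumes "A \<subseteq> carrier L"
  shows "is_lub L s A \<longleftrightarrow>
    s \<in> carrier L \<and> (\<forall>a\<in>A. a \<sqsubseteq>\<^bsub>L\<^esub> s) \<and>
    (\<forall>u\<in>carrier L. (\<forall>a\<in>A. a \<sqsubseteq>\<^bsub>L\<^esub> u) \<longrightarrow> s \<sqsubseteq>\<^bsub>L\<^esub> u)"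
  using assms by (auto simp: least_def Upper_def subset_iff)

lemma way_belowD:
  assumes "way_below L x y" "directed_in L A" "is_lub L s A" "y \<sqsubseteq>\<^bsub>L\<^esub> s"
  shows "\<exists>d\<in>A. x \<sqsubseteq>\<^bsub>L\<^esub> d"
  using assms unfolding way_below_def by blast

lemma (in partial_order) directed_finite_upper:
  assumes "directed_in L A" "finite M" "\<forall>m\<in>M. m \<in> carrier L \<and> (\<exists>a\<in>A. m \<sqsubseteq> a)"
  shows "\<exists>a\<in>A. \<forall>m\<in>M. m \<sqsubseteq> a"
  using assms(2,3)
proof (induction M)
  case empty
  then show ?case using assms(1) unfolding directed_in_def by auto
next
  case (insert x M)
  then obtain a b where ab: "a \<in> A" "\<forall>m\<in>M. m \<sqsubseteq> a" "b \<in> A" "x \<sqsubseteq> b" by auto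
  then obtain c where c: "c \<in> A" "a \<sqsubseteq> c" "b \<sqsubseteq> c"
    using assms(1) unfolding directed_in_def by blast
  have "A \<subseteq> carrier L" using assms(1) unfolding directed_in_def by blast
  with ab c have "a \<in> carrier L" "b \<in> carrier L" "c \<in> carrier L" by auto
  then have "m \<sqsubseteq> c" if "m \<in> insert x M" for m
    using that ab c insert.prems le_trans[of m a c] le_trans[of m b c] by auto
  then show ?case using c by blast
qed

text \<open>The singleton \<open>{y}\<close> is directed with supremum \<open>y\<close>, so it can
  serve as the test family.\<close>

lemma (in partial_order) way_below_le:
  assumes "way_below L x y"
  shows "x \<sqsubseteq> y"
proof -
  have y: "y \<in> carrier L" using assms unfolding way_below_def by blast
  then have "directed_in L {y}" "is_lub L y {y}"
    by (auto simp: directed_in_def is_lub_iff)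
  from way_belowD[OF assms this] y show ?thesis by simp
qed

lemma (in partial_order) way_below_le_trans:
  assumes "way_below L x y" "y \<sqsubseteq> z" "z \<in> carrier L"
  shows "way_below L x z"
proof -
  have "y \<sqsubseteq> s" if "z \<sqsubseteq> s" "is_lub L s A" for s A
  proof -
    have "s \<in> carrier L" using that(2) by (simp add: least_def Upper_def)
    moreover have "y \<in> carrier L" using assms(1) unfolding way_below_def by blast
    ultimately show ?thesis using assms(2,3) that(1) le_trans by blast
  qed
  then show ?thesis using assms(1,3) unfolding way_below_def by blast
qed

lemma (in partial_order) le_way_below_trans:
  assumes "x \<sqsubseteq> y" "way_below L y z" "x \<in> carrier L"
  shows "way_below L x z"
  unfolding way_below_def
proof (intro conjI allI impI)
  show "x \<in> carrier L" "z \<in> carrier L" using assms unfolding way_below_def by auto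
  fix A s assume "directed_in L A \<and> is_lub L s A \<and> z \<sqsubseteq> s"
  then have A: "directed_in L A" "is_lub L s A" "z \<sqsubseteq> s" by auto
  then obtain d where "d \<in> A" "y \<sqsubseteq> d" using way_belowD[OF assms(2)] by blast
  moreover have "y \<in> carrier L" "A \<subseteq> carrier L"
    using assms(2) A(1) unfolding way_below_def directed_in_def by auto
  ultimately show "\<exists>d\<in>A. x \<sqsubseteq> d" using assms(1,3) by (meson le_trans subsetD)
qed

section \<open>Concepts form a continuous domain\<close>

context attribute_continuous_context
begin

abbreviation hull :: "'n set \<Rightarrow> 'n set" where
  "hull \<equiv> kernel_hull objs attrs inc \<tau>"

abbreviation concepts :: "'n set set" where
  "concepts \<equiv> continuous_concepts objs attrs inc \<tau> \<F>"

abbreviation poset :: "'n set gorder" where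
  "poset \<equiv> concept_poset objs attrs inc \<tau> \<F>"

lemma poset_simps [simp]:
  "carrier poset = concepts" "le poset = (\<subseteq>)" "eq poset = (=)"
  by (simp_all add: concept_poset_def)

section \<open>Hulls and finite approximation of concepts\<close>

lemma attr_closure_subset: "attr_closure objs attrs inc B \<subseteq> attrs"
  unfolding attr_closure_def ctx_alpha_def by blast

lemma hull_subset_attrs: "hull B \<subseteq> attrs"
  using kernel_maps attr_closure_subset unfolding kernel_hull_def by blast

lemma hull_mono: "B \<subseteq> C \<Longrightarrow> C \<subseteq> attrs \<Longrightarrow> hull B \<subseteq> hull C"
  unfolding kernel_hull_def by (rule kernel_mono)

text \<open>Contractivity puts \<open>G\<close> inside the closure of \<open>F\<close>. Closure is
  idempotent, as for every Galois connection, so monotonicity of the hull suffices.\<close>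

lemma hull_least:
  assumes "G \<subseteq> hull F" "F \<subseteq> attrs"
  shows "hull G \<subseteq> hull F"
proof -
  have "G \<subseteq> attr_closure objs attrs inc F"
    using assms kernel_contractive unfolding kernel_hull_def by blast
  then have "hull G \<subseteq> hull (attr_closure objs attrs inc F)"
    using attr_closure_subset by (rule hull_mono)
  also have "attr_closure objs attrs inc (attr_closure objs attrs inc F)
      = attr_closure objs attrs inc F"
    using assms(2) unfolding attr_closure_def ctx_alpha_def ctx_omega_def by blast
  then have "hull (attr_closure objs attrs inc F) = hull F"
    unfolding kernel_hull_def by simp
  finally show ?thesis .
qed

lemma selectionD:
  assumes "F \<in> \<F>"
  shows "finite F" "F \<subseteq> attrs"
  using selection assms unfolding consistent_selection_def by auto

lemma selection_interpolate:
  assumes "F \<in> \<F>" "finite M" "M \<subseteq> hull F"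
  obtains G where "G \<in> \<F>" "M \<subseteq> hull G" "G \<subseteq> hull F"
  using selection assms unfolding consistent_selection_def by blast

lemma concept_obtain:
  assumes "Q \<in> concepts" "finite M" "M \<subseteq> Q"
  obtains F where "F \<in> \<F>" "M \<subseteq> hull F" "hull F \<subseteq> Q"
  using assms unfolding continuous_concepts_def by blast

text \<open>Interpolating once more replaces \<open>hull F \<subseteq> Q\<close> by
  \<open>G \<subseteq> Q\<close>, the condition under which \<open>hull G\<close> is way below
  \<open>Q\<close>.\<close>

lemma concept_obtain_inside:
  assumes "Q \<in> concepts" "finite M" "M \<subseteq> Q"
  obtains G where "G \<in> \<F>" "M \<subseteq> hull G" "G \<subseteq> Q"
proof -
  obtain F where F: "F \<in> \<F>" "M \<subseteq> hull F" "hull F \<subseteq> Q" using concept_obtain[OF assms] .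
  obtain G where "G \<in> \<F>" "M \<subseteq> hull G" "G \<subseteq> hull F"
    using selection_interpolate[OF F(1) assms(2) F(2)] .
  then show ?thesis using that F(3) by blast
qed

text \<open>Since \<open>F\<close> is finite, it may itself be taken as the finite set in the
  concept condition.\<close>

lemma hull_subset_concept:
  assumes "Q \<in> concepts" "F \<in> \<F>" "F \<subseteq> Q"
  shows "hull F \<subseteq> Q"
proof -
  obtain G where "G \<in> \<F>" "F \<subseteq> hull G" "hull G \<subseteq> Q"
    using concept_obtain[OF assms(1) selectionD(1)[OF assms(2)] assms(3)] .
  then show ?thesis using hull_least[OF _ selectionD(2)] by blast
qed

lemma hull_concept:
  assumes "F \<in> \<F>"
  shows "hull F \<in> concepts"
proof -
  have "\<exists>G\<in>\<F>. M \<subseteq> hull G \<and> hull G \<subseteq> hull F" if M: "finite M" "M \<subseteq> hull F" for M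
  proof -
    obtain G where "G \<in> \<F>" "M \<subseteq> hull G" "G \<subseteq> hull F"
      using selection_interpolate[OF assms M] .
    then show ?thesis using hull_least[OF _ selectionD(2)[OF assms]] by blast
  qed
  then show ?thesis
    using hull_subset_attrs unfolding continuous_concepts_def by blast
qed

section \<open>Directed suprema of concepts\<close>

lemma poset_partial_order: "partial_order poset"
  by unfold_locales auto

lemma directed_finite_subset:
  assumes "directed_in poset A" "finite M" "M \<subseteq> \<Union>A"
  obtains Q where "Q \<in> A" "M \<subseteq> Q"
proof -
  from assms(2,3) have "\<exists>Q\<in>A. M \<subseteq> Q"
  proof (induction M)
    case empty
    then show ?case using assms(1) unfolding directed_in_def by auto
  next
    case (insert x M)
    then obtain P Q where "P \<in> A" "x \<in> P" "Q \<in> A" "M \<subseteq> Q" by auto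
    moreover from this have "\<exists>R\<in>A. P \<subseteq> R \<and> Q \<subseteq> R"
      using assms(1) unfolding directed_in_def by auto
    ultimately show ?case by blast
  qed
  then show ?thesis using that by blast
qed

text \<open>A finite subset of the union lies in a single member of \<open>A\<close>, so the concept
  condition, being finitary, carries over from that member.\<close>

lemma directed_Union:
  assumes "directed_in poset A"
  shows "\<Union>A \<in> concepts" "is_lub poset (\<Union>A) A"
proof -
  have A: "A \<subseteq> concepts" using assms unfolding directed_in_def by simp
  then have "\<Union>A \<subseteq> attrs" unfolding continuous_concepts_def by blast
  moreover have "\<exists>F\<in>\<F>. M \<subseteq> hull F \<and> hull F \<subseteq> \<Union>A" if "finite M" "M \<subseteq> \<Union>A" for M
  proof -
    obtain Q where "Q \<in> A" "M \<subseteq> Q" using directed_finite_subset[OF assms \<open>finite M\<close> \<open>M \<subseteq> \<Union>A\<close>] .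
    moreover from this obtain F where "F \<in> \<F>" "M \<subseteq> hull F" "hull F \<subseteq> Q"
      using A \<open>finite M\<close> concept_obtain by blast
    ultimately show ?thesis by blast
  qed
  ultimately show "\<Union>A \<in> concepts" unfolding continuous_concepts_def by blast
  then show "is_lub poset (\<Union>A) A" using A by (auto simp: is_lub_iff)
qed

lemma is_lub_directed:
  assumes "directed_in poset A" "is_lub poset S A"
  shows "S = \<Union>A"
proof -
  interpret partial_order poset by (rule poset_partial_order)
  show ?thesis using least_unique assms(2) directed_Union(2)[OF assms(1)] .
qed

lemma poset_dcpo: "dcpo poset"
proof -
  interpret partial_order poset by (rule poset_partial_order)
  obtain F where "F \<in> \<F>" using selection unfolding consistent_selection_def by blast
  then have "carrier poset \<noteq> {}" using hull_concept by auto
  then show ?thesis using directed_Union(2) by unfold_locales blast+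
qed

text \<open>If the supremum of a directed family contains \<open>Q\<close>, then the finite set
  \<open>F\<close> already lies in one member, and that member, being a concept, contains
  \<open>hull F\<close>.\<close>

lemma hull_way_below:
  assumes "Q \<in> concepts" "F \<in> \<F>" "F \<subseteq> Q"
  shows "way_below poset (hull F) Q"
  unfolding way_below_def
proof (intro conjI allI impI)
  show "hull F \<in> carrier poset" "Q \<in> carrier poset" using assms hull_concept by auto
  fix A S assume *: "directed_in poset A \<and> is_lub poset S A \<and> Q \<sqsubseteq>\<^bsub>poset\<^esub> S"
  then have "F \<subseteq> \<Union>A" using is_lub_directed assms(3) by auto
  with * obtain P where P: "P \<in> A" "F \<subseteq> P"
    using directed_finite_subset[OF _ selectionD(1)[OF assms(2)]] by blast
  then have "P \<in> concepts" using * unfolding directed_in_def by auto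
  then show "\<exists>P\<in>A. hull F \<sqsubseteq>\<^bsub>poset\<^esub> P" using hull_subset_concept P assms(2) by auto
qed

section \<open>The basis of hulls\<close>

lemma inner_hulls_directed:
  assumes "Q \<in> concepts"
  shows "directed_in poset {hull F |F. F \<in> \<F> \<and> F \<subseteq> Q}" (is "directed_in _ ?H")
  unfolding directed_in_def
proof (intro conjI ballI)
  show "?H \<subseteq> carrier poset" using hull_concept by auto
  \<comment> \<open>The concept condition for the empty set is what yields a member.\<close>
  show "?H \<noteq> {}" using concept_obtain_inside[OF assms, of "{}"] by auto
  fix X Y assume "X \<in> ?H" "Y \<in> ?H"
  then obtain F G where FG: "F \<in> \<F>" "F \<subseteq> Q" "X = hull F" "G \<in> \<F>" "G \<subseteq> Q" "Y = hull G" by blast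
  then obtain H where H: "H \<in> \<F>" "F \<union> G \<subseteq> hull H" "H \<subseteq> Q"
    using concept_obtain_inside[OF assms, of "F \<union> G"] selectionD by auto
  then have "X \<subseteq> hull H" "Y \<subseteq> hull H" using FG hull_least selectionD by auto
  then show "\<exists>Z\<in>?H. X \<sqsubseteq>\<^bsub>poset\<^esub> Z \<and> Y \<sqsubseteq>\<^bsub>poset\<^esub> Z" using H by auto
qed

lemma inner_hulls_Union:
  assumes "Q \<in> concepts"
  shows "\<Union>{hull F |F. F \<in> \<F> \<and> F \<subseteq> Q} = Q"
proof
  show "\<Union>{hull F |F. F \<in> \<F> \<and> F \<subseteq> Q} \<subseteq> Q" using hull_subset_concept[OF assms] by blast
  show "Q \<subseteq> \<Union>{hull F |F. F \<in> \<F> \<and> F \<subseteq> Q}"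
  proof
    fix x assume "x \<in> Q"
    then obtain G where "G \<in> \<F>" "{x} \<subseteq> hull G" "G \<subseteq> Q"
      using concept_obtain_inside[OF assms, of "{x}"] by auto
    then show "x \<in> \<Union>{hull F |F. F \<in> \<F> \<and> F \<subseteq> Q}" by blast
  qed
qed

lemma hulls_basis: "domain_basis poset (hull ` \<F>)"
proof -
  interpret partial_order poset by (rule poset_partial_order)
  define W where "W Q = {X \<in> hull ` \<F>. way_below poset X Q}" for Q
  have W_carrier: "W Q \<subseteq> carrier poset" for Q unfolding W_def using hull_concept by auto
  have "directed_in poset (W Q) \<and> is_lub poset Q (W Q)" if Q: "Q \<in> concepts" for Q
  proof -
    define H where "H = {hull F |F. F \<in> \<F> \<and> F \<subseteq> Q}"
    have H: "directed_in poset H" and UH: "\<Union>H = Q"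
      unfolding H_def by (rule inner_hulls_directed[OF Q], rule inner_hulls_Union[OF Q])
    have sub: "H \<subseteq> W Q" unfolding H_def W_def using hull_way_below Q by auto
    \<comment> \<open>Testing way-belowness against \<open>H\<close>, which is directed with
      supremum \<open>Q\<close>, makes \<open>H\<close> cofinal in \<open>W Q\<close>. Directedness
      and the union then pass from \<open>H\<close> to \<open>W Q\<close>.\<close>
    have cof: "\<exists>Y\<in>H. X \<subseteq> Y" if "X \<in> W Q" for X
    proof -
      have "way_below poset X Q" using that unfolding W_def by blast
      from way_belowD[OF this H directed_Union(2)[OF H]] UH show ?thesis by simp
    qed
    have dir: "directed_in poset (W Q)"
      unfolding directed_in_def
    proof (intro conjI ballI)
      show "W Q \<subseteq> carrier poset" by (rule W_carrier)
      show "W Q \<noteq> {}" using sub H unfolding directed_in_def by blast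
      fix X Y assume "X \<in> W Q" "Y \<in> W Q"
      then obtain X' Y' where XY: "X' \<in> H" "X \<subseteq> X'" "Y' \<in> H" "Y \<subseteq> Y'" using cof by meson
      then have "\<exists>Z\<in>H. X' \<subseteq> Z \<and> Y' \<subseteq> Z" using H unfolding directed_in_def by simp
      then show "\<exists>Z\<in>W Q. X \<sqsubseteq>\<^bsub>poset\<^esub> Z \<and> Y \<sqsubseteq>\<^bsub>poset\<^esub> Z"
        using sub XY unfolding poset_simps by (meson subset_iff)
    qed
    have "X \<subseteq> Q" if "X \<in> W Q" for X
      using that way_below_le unfolding W_def by simp
    then have "\<Union>(W Q) = Q" using sub UH by (intro subset_antisym) (blast, blast)
    then show ?thesis using dir directed_Union(2)[OF dir] by simp
  qed
  then show ?thesis unfolding domain_basis_def W_def using hull_concept by auto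
qed

theorem continuous_domain_poset: "continuous_domain poset"
  using hulls_basis by (intro continuous_domain.intro poset_dcpo continuous_domain_axioms.intro) blast

end

section \<open>Representing a continuous domain\<close>

text \<open>Names one basis, because the context to be built depends on the choice.\<close>

locale based_domain = dcpo +
  fixes B :: "'a set"
  assumes basis: "domain_basis L B"
begin

definition below :: "'a \<Rightarrow> 'a set" where
  "below x = {b \<in> B. way_below L b x}"

text \<open>For \<open>A \<subseteq> B\<close>, \<open>ctx_omega\<close> thus gives the upper bounds
  of \<open>A\<close>, and \<open>attr_closure\<close> gives the basis elements below all these
  upper bounds.\<close>

definition ctx_inc :: "('a \<times> 'a) set" where
  "ctx_inc = {(m, n). m \<in> carrier L \<and> n \<in> B \<and> n \<sqsubseteq> m}"

definition ctx_tau :: "'a set \<Rightarrow> 'a set" where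
  "ctx_tau X = (\<Union>b\<in>X. below b)"

abbreviation singletons :: "'a set set" where
  "singletons \<equiv> (\<lambda>b. {b}) ` B"

lemma B_carrier: "b \<in> B \<Longrightarrow> b \<in> carrier L"
  using basis unfolding domain_basis_def by blast

lemma below_iff: "b \<in> below x \<longleftrightarrow> b \<in> B \<and> way_below L b x"
  unfolding below_def by blast

lemma below_directed: "x \<in> carrier L \<Longrightarrow> directed_in L (below x)"
  and below_lub: "x \<in> carrier L \<Longrightarrow> is_lub L x (below x)"
  using basis unfolding domain_basis_def below_def by auto

lemma below_least:
  assumes "x \<in> carrier L" "u \<in> carrier L" "\<forall>b\<in>below x. b \<sqsubseteq> u"
  shows "x \<sqsubseteq> u"
proof -
  have "below x \<subseteq> carrier L" using B_carrier below_iff by blast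
  then show ?thesis using below_lub[OF assms(1)] assms(2,3) is_lub_iff by metis
qed

lemma below_mono: "x \<sqsubseteq> y \<Longrightarrow> y \<in> carrier L \<Longrightarrow> below x \<subseteq> below y"
  using way_below_le_trans by (auto simp: below_iff)

text \<open>As \<open>x\<close> is the supremum of \<open>below x\<close>, the order can be read off
  these sets; this makes \<open>below\<close> the order embedding of the final isomorphism.\<close>

lemma below_subset_iff:
  assumes "x \<in> carrier L" "y \<in> carrier L"
  shows "below x \<subseteq> below y \<longleftrightarrow> x \<sqsubseteq> y"
proof
  assume "below x \<subseteq> below y"
  then have "\<forall>b\<in>below x. b \<sqsubseteq> y" using below_iff way_below_le by blast
  then show "x \<sqsubseteq> y" using assms below_least by blast
next
  assume "x \<sqsubseteq> y"
  then show "below x \<subseteq> below y" using below_mono assms by blast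
qed

text \<open>The basis elements that are two way-below steps beneath \<open>x\<close> already have supremum \<open>x\<close>.\<close>

lemma interpolation:
  assumes "way_below L a x"
  obtains b where "b \<in> below x" "way_below L a b"
proof -
  have x: "x \<in> carrier L" and a: "a \<in> carrier L" using assms unfolding way_below_def by auto
  let ?A = "\<Union>b\<in>below x. below b"
  have car: "?A \<subseteq> carrier L" using below_iff B_carrier by blast
  have bcar: "b \<in> carrier L" if "b \<in> below y" for b y using that below_iff B_carrier by blast
  have dir: "directed_in L ?A"
    unfolding directed_in_def
  proof (intro conjI ballI)
    show "?A \<subseteq> carrier L" by (rule car)
    obtain b where b: "b \<in> below x" using below_directed[OF x] unfolding directed_in_def by blast
    moreover obtain c where "c \<in> below b"
      using below_directed[OF bcar[OF b]] unfolding directed_in_def by blast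
    ultimately show "?A \<noteq> {}" by blast
    fix c d assume "c \<in> ?A" "d \<in> ?A"
    then obtain b b' where b: "b \<in> below x" "c \<in> below b" "b' \<in> below x" "d \<in> below b'" by blast
    then obtain e where e: "e \<in> below x" "b \<sqsubseteq> e" "b' \<sqsubseteq> e"
      using below_directed[OF x] unfolding directed_in_def by blast
    \<comment> \<open>Both elements move beneath the common bound \<open>e\<close>, where
      directedness of \<open>below e\<close> applies.\<close>
    then have "c \<in> below e" "d \<in> below e" using b below_mono bcar by blast+
    then obtain f where "f \<in> below e" "c \<sqsubseteq> f" "d \<sqsubseteq> f"
      using below_directed[OF bcar[OF e(1)]] unfolding directed_in_def by blast
    then show "\<exists>z\<in>?A. c \<sqsubseteq> z \<and> d \<sqsubseteq> z" using e by blast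
  qed
  obtain s where s: "is_lub L s ?A" using directed_has_lub[OF dir] by blast
  then have s': "s \<in> carrier L" "\<forall>c\<in>?A. c \<sqsubseteq> s" unfolding is_lub_iff[OF car] by blast+
  \<comment> \<open>The bound \<open>s\<close> dominates all of \<open>below b\<close>, hence its
    supremum \<open>b\<close>; the same argument one level up gives
    \<open>x \<sqsubseteq> s\<close>.\<close>
  have "b \<sqsubseteq> s" if "b \<in> below x" for b
    using below_least[OF bcar[OF that] s'(1)] s'(2) that by blast
  then have "x \<sqsubseteq> s" using below_least[OF x s'(1)] by blast
  then obtain c where "c \<in> ?A" "a \<sqsubseteq> c" using way_belowD[OF assms dir s] by blast
  then obtain b where "b \<in> below x" "way_below L c b" using below_iff by blast
  then show ?thesis using that le_way_below_trans[OF \<open>a \<sqsubseteq> c\<close> _ a] by blast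
qed

text \<open>Each \<open>m\<close> is interpolated separately by some \<open>f m\<close>;
  directedness of \<open>below x\<close> bounds these finitely many interpolants by one
  \<open>b\<close>.\<close>

lemma finite_interpolation:
  assumes "x \<in> carrier L" "finite M" "M \<subseteq> below x"
  obtains b where "b \<in> below x" "M \<subseteq> below b"
proof -
  have "\<forall>m\<in>M. \<exists>b. b \<in> below x \<and> way_below L m b"
    using assms(3) below_iff interpolation by (metis subsetD)
  then obtain f where f: "\<forall>m\<in>M. f m \<in> below x \<and> way_below L m (f m)" by metis
  have car: "below x \<subseteq> carrier L" using below_iff B_carrier by blast
  then have "\<forall>m\<in>f ` M. m \<in> carrier L \<and> (\<exists>a\<in>below x. m \<sqsubseteq> a)" using f le_refl by fast
  from directed_finite_upper[OF below_directed[OF assms(1)] finite_imageI[OF assms(2)] this]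
  obtain b where b: "b \<in> below x" "\<forall>m\<in>M. f m \<sqsubseteq> b" by auto
  have "m \<in> below b" if "m \<in> M" for m
  proof -
    have "way_below L m b"
      using that f b car way_below_le_trans[of m "f m" b] by blast
    then show ?thesis using that assms(3) below_iff by blast
  qed
  then show ?thesis using that b(1) by blast
qed

section \<open>Verifying the context axioms\<close>

lemma attr_closure_lower:
  assumes "x \<in> attr_closure (carrier L) B ctx_inc A" "b \<in> B" "b \<sqsubseteq> x"
  shows "b \<in> attr_closure (carrier L) B ctx_inc A"
  using assms B_carrier le_trans[of b x]
  unfolding attr_closure_def ctx_alpha_def ctx_omega_def ctx_inc_def by auto

lemma attr_closure_singleton:
  assumes "b \<in> B"
  shows "attr_closure (carrier L) B ctx_inc {b} = {c \<in> B. c \<sqsubseteq> b}"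
  using assms B_carrier le_trans[of _ b]
  unfolding attr_closure_def ctx_alpha_def ctx_omega_def ctx_inc_def by auto

text \<open>The closure of \<open>{b}\<close> has greatest element \<open>b\<close>, so by
  monotonicity the union defining \<open>ctx_tau\<close> collapses to
  \<open>below b\<close>.\<close>

lemma hull_singleton:
  assumes "b \<in> B"
  shows "kernel_hull (carrier L) B ctx_inc ctx_tau {b} = below b"
proof -
  have "b \<sqsubseteq> b" using assms B_carrier by simp
  then show ?thesis
    using assms below_mono[OF _ B_carrier[OF assms]]
    unfolding kernel_hull_def attr_closure_singleton[OF assms] ctx_tau_def by blast
qed

text \<open>One inclusion is transitivity of way-below, the other is interpolation.\<close>

lemma ctx_tau_idem: "ctx_tau (ctx_tau X) = ctx_tau X"
proof
  show "ctx_tau (ctx_tau X) \<subseteq> ctx_tau X"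
  proof
    fix a assume "a \<in> ctx_tau (ctx_tau X)"
    then obtain b x where "x \<in> X" and b: "b \<in> below x" "a \<in> below b" unfolding ctx_tau_def by blast
    moreover have "x \<in> carrier L" using b unfolding below_def way_below_def by blast
    moreover have "b \<sqsubseteq> x" using b(1) below_iff way_below_le by blast
    ultimately show "a \<in> ctx_tau X"
      using below_mono unfolding ctx_tau_def by blast
  qed
  show "ctx_tau X \<subseteq> ctx_tau (ctx_tau X)"
  proof
    fix a assume "a \<in> ctx_tau X"
    then obtain x where "x \<in> X" "a \<in> B" "way_below L a x"
      unfolding ctx_tau_def below_def by blast
    moreover from this(3) obtain b where "b \<in> below x" "way_below L a b" by (rule interpolation)
    ultimately show "a \<in> ctx_tau (ctx_tau X)" unfolding ctx_tau_def using below_iff by blast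
  qed
qed

lemma ctx_context: "attribute_continuous_context (carrier L) B ctx_inc ctx_tau singletons"
proof unfold_locales
  show "ctx_inc \<subseteq> carrier L \<times> B" unfolding ctx_inc_def by auto
  show "ctx_tau \<in> Pow B \<rightarrow> Pow B" unfolding ctx_tau_def below_def by auto
  show "ctx_tau (attr_closure (carrier L) B ctx_inc A) \<subseteq> attr_closure (carrier L) B ctx_inc A" for A
    \<comment> \<open>Closures are lower sets within \<open>B\<close>, so they keep everything way
      below their members.\<close>
    using attr_closure_lower way_below_le unfolding ctx_tau_def below_def by fast
  show "ctx_tau (ctx_tau (attr_closure (carrier L) B ctx_inc A))
      = ctx_tau (attr_closure (carrier L) B ctx_inc A)" for A
    by (rule ctx_tau_idem)
  show "ctx_tau (attr_closure (carrier L) B ctx_inc A)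
      \<subseteq> ctx_tau (attr_closure (carrier L) B ctx_inc A')" if "A \<subseteq> A'" for A A'
  proof -
    have "attr_closure (carrier L) B ctx_inc A \<subseteq> attr_closure (carrier L) B ctx_inc A'"
      using that unfolding attr_closure_def ctx_alpha_def ctx_omega_def by blast
    then show ?thesis unfolding ctx_tau_def by blast
  qed
  obtain x where "x \<in> carrier L" using carrier_nonempty by blast
  then have "B \<noteq> {}" using below_directed unfolding directed_in_def below_def by blast
  \<comment> \<open>For singletons the selection condition is finite interpolation at a basis
    element.\<close>
  moreover have "\<exists>c\<in>B. M \<subseteq> below c \<and> c \<in> below b"
    if b: "b \<in> B" and M: "finite M" "M \<subseteq> below b" for b M
  proof -
    obtain c where "c \<in> below b" "M \<subseteq> below c"
      using finite_interpolation[OF B_carrier[OF b] M] .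
    then show ?thesis using below_iff by blast
  qed
  ultimately show "consistent_selection (carrier L) B ctx_inc ctx_tau singletons"
    unfolding consistent_selection_def by (auto simp: hull_singleton)
qed

section \<open>Rounded ideals and the isomorphism\<close>

lemma concepts_iff:
  "Q \<in> continuous_concepts (carrier L) B ctx_inc ctx_tau singletons \<longleftrightarrow>
    Q \<subseteq> B \<and> (\<forall>M. finite M \<and> M \<subseteq> Q \<longrightarrow> (\<exists>b\<in>B. M \<subseteq> below b \<and> below b \<subseteq> Q))"
  unfolding continuous_concepts_def by (simp add: hull_singleton)

lemma below_concept:
  assumes "x \<in> carrier L"
  shows "below x \<in> continuous_concepts (carrier L) B ctx_inc ctx_tau singletons"
  unfolding concepts_iff
proof (intro conjI allI impI)
  show "below x \<subseteq> B" unfolding below_def by blast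
  fix M assume "finite M \<and> M \<subseteq> below x"
  then have "finite M" "M \<subseteq> below x" by auto
  then obtain b where "b \<in> below x" "M \<subseteq> below b" by (rule finite_interpolation[OF assms])
  moreover from this have "b \<in> B" "b \<sqsubseteq> x" using below_iff way_below_le by blast+
  ultimately show "\<exists>b\<in>B. M \<subseteq> below b \<and> below b \<subseteq> below x"
    using below_mono[OF _ assms] by blast
qed

text \<open>The point \<open>s\<close> is the supremum of \<open>Q\<close>: the concept condition
  for the empty set and for pairs makes \<open>Q\<close> directed.\<close>

lemma concept_is_below:
  assumes "Q \<in> continuous_concepts (carrier L) B ctx_inc ctx_tau singletons"
  obtains s where "s \<in> carrier L" "Q = below s"
proof -
  have QB: "Q \<subseteq> B" using assms concepts_iff by blast
  have ex: "\<exists>b\<in>B. M \<subseteq> below b \<and> below b \<subseteq> Q" if "finite M" "M \<subseteq> Q" for M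
    using assms that concepts_iff by blast
  have car: "Q \<subseteq> carrier L" using QB B_carrier by blast
  have dir: "directed_in L Q"
    unfolding directed_in_def
  proof (intro conjI ballI)
    show "Q \<subseteq> carrier L" by (rule car)
    obtain b where "b \<in> B" "below b \<subseteq> Q" using ex[of "{}"] by auto
    then show "Q \<noteq> {}" using below_directed B_carrier unfolding directed_in_def by blast
    fix p q assume "p \<in> Q" "q \<in> Q"
    then obtain b where b: "b \<in> B" "p \<in> below b" "q \<in> below b" "below b \<subseteq> Q" using ex[of "{p, q}"] by auto
    then obtain r where "r \<in> below b" "p \<sqsubseteq> r" "q \<sqsubseteq> r"
      using below_directed[OF B_carrier[OF b(1)]] unfolding directed_in_def by blast
    then show "\<exists>z\<in>Q. p \<sqsubseteq> z \<and> q \<sqsubseteq> z" using b by blast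
  qed
  obtain s where s: "is_lub L s Q" using directed_has_lub[OF dir] by blast
  then have s': "s \<in> carrier L" "\<forall>q\<in>Q. q \<sqsubseteq> s" unfolding is_lub_iff[OF car] by blast+
  have "Q = below s"
  proof
    show "Q \<subseteq> below s"
    proof
      fix q assume "q \<in> Q"
      then obtain b where b: "b \<in> B" "q \<in> below b" "below b \<subseteq> Q" using ex[of "{q}"] by auto
      \<comment> \<open>All of \<open>below b\<close> lies in \<open>Q\<close>, so \<open>s\<close>
        bounds it and therefore also its supremum \<open>b\<close>.\<close>
      then have "b \<sqsubseteq> s" using below_least[OF B_carrier s'(1)] s'(2) by blast
      then show "q \<in> below s" using b below_mono[OF _ s'(1)] by blast
    qed
    show "below s \<subseteq> Q"
    proof
      fix q assume q: "q \<in> below s"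
      then have "q \<in> B" "q \<in> carrier L" using below_iff B_carrier by blast+
      have "way_below L q s" using q below_iff by blast
      then obtain r where r: "r \<in> Q" "q \<sqsubseteq> r"
        using way_belowD[OF _ dir s le_refl[OF s'(1)]] by blast
      \<comment> \<open>The concept condition for \<open>{r}\<close> supplies roundness: from
        \<open>q \<sqsubseteq> r\<close> and \<open>r\<close> way below \<open>b\<close>, the
        element \<open>q\<close> falls into \<open>below b\<close>, which lies inside
        \<open>Q\<close>.\<close>
      then obtain b where "b \<in> B" "r \<in> below b" "below b \<subseteq> Q" using ex[of "{r}"] by auto
      moreover from this have "way_below L q b"
        using le_way_below_trans[OF r(2) _ \<open>q \<in> carrier L\<close>] below_iff by blast
      ultimately show "q \<in> Q" using \<open>q \<in> B\<close> below_iff by blast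
    qed
  qed
  then show ?thesis using that s' by blast
qed

lemma order_isomorphic_concepts:
  "order_isomorphic L (concept_poset (carrier L) B ctx_inc ctx_tau singletons)"
  unfolding order_isomorphic_def
proof (intro exI conjI)
  show "bij_betw below (carrier L) (carrier (concept_poset (carrier L) B ctx_inc ctx_tau singletons))"
    unfolding bij_betw_def
  proof
    show "inj_on below (carrier L)"
      by (rule inj_onI) (metis below_subset_iff le_antisym order_refl)
    show "below ` carrier L = carrier (concept_poset (carrier L) B ctx_inc ctx_tau singletons)"
    proof
      show "below ` carrier L \<subseteq> carrier (concept_poset (carrier L) B ctx_inc ctx_tau singletons)"
        using below_concept unfolding concept_poset_def by auto
      show "carrier (concept_poset (carrier L) B ctx_inc ctx_tau singletons) \<subseteq> below ` carrier L"
      proof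
        fix Q assume "Q \<in> carrier (concept_poset (carrier L) B ctx_inc ctx_tau singletons)"
        then have "Q \<in> continuous_concepts (carrier L) B ctx_inc ctx_tau singletons"
          unfolding concept_poset_def by simp
        then obtain s where "s \<in> carrier L" "Q = below s" by (rule concept_is_below)
        then show "Q \<in> below ` carrier L" by blast
      qed
    qed
  qed
  show "order_emb L (concept_poset (carrier L) B ctx_inc ctx_tau singletons) below"
    unfolding order_emb_def
  proof (intro conjI ballI)
    show "weak_partial_order L" by (rule weak_partial_order_axioms)
    show "weak_partial_order (concept_poset (carrier L) B ctx_inc ctx_tau singletons)"
      using attribute_continuous_context.poset_partial_order[OF ctx_context]
      by (rule partial_order.axioms(1))
  qed (simp add: concept_poset_def below_subset_iff)
qed

end

theorem theorem3p15:
  shows "(\<forall>(objs :: 'm set) (attrs :: 'n set) inc \<tau> \<F>.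
            attribute_continuous_context objs attrs inc \<tau> \<F> \<longrightarrow>
              continuous_domain (concept_poset objs attrs inc \<tau> \<F>)) \<and>
         (\<forall>D :: 'd gorder.
            continuous_domain D \<longrightarrow>
              (\<exists>(objs :: 'd set) (attrs :: 'd set) inc \<tau> \<F>.
                 attribute_continuous_context objs attrs inc \<tau> \<F> \<and>
                 order_isomorphic D (concept_poset objs attrs inc \<tau> \<F>)))"
proof (intro conjI allI impI)
  show "continuous_domain (concept_poset objs attrs inc \<tau> \<F>)"
    if "attribute_continuous_context objs attrs inc \<tau> \<F>"
    for objs :: "'m set" and attrs :: "'n set" and inc \<tau> \<F>
    using that by (rule attribute_continuous_context.continuous_domain_poset)
  fix D :: "'d gorder"
  assume "continuous_domain D"
  then interpret continuous_domain D .
  obtain B where "domain_basis D B" using has_basis by blast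
  then interpret based_domain D B by unfold_locales
  show "\<exists>(objs :: 'd set) (attrs :: 'd set) inc \<tau> \<F>.
      attribute_continuous_context objs attrs inc \<tau> \<F> \<and>
      order_isomorphic D (concept_poset objs attrs inc \<tau> \<F>)"
    using ctx_context order_isomorphic_concepts by blast
qed

end
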